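(* Let $\alpha,\beta>0$ and $a\ge0$. The function $$\widehat V_1(x)=\frac{\Gamma(x/\alpha+a)^{\alpha}\,\alpha^x}{\Gamma(x/\beta+a)^{\beta}\,\beta^x},\qquad x>0,$$ is logarithmically completely monotonic and the function $$(\log\widehat W_1)'(x)=\psi(x/\alpha+a)-\psi(x/\beta+a),\qquad x>0,$$ is a Bernstein function if and only if $\alpha\le\beta$ and, if $\alpha\ne\beta$, $a\ge1/2$.
   Context: $\Gamma$ is Euler's gamma function and $\psi=\Gamma'/\Gamma$ is the digamma function; $\widehat W_1(x)=\Gamma(x/\alpha+a)^{\alpha}/\Gamma(x/\beta+a)^{\beta}$. A function $f:(0,\infty)\to\mathbb R$ is completely monotonic if it is infinitely differentiable, $f\ge0$, and $(-1)^nf^{(n)}(x)\ge0$ for all $n\ge1$, $x>0$. A Bernstein function is an infinitely differentiable function $g:(0,\infty)\to[0,\infty)$ such that $g'$ is completely monotonic. A positive function $f$ on $(0,\infty)$ is logarithmically completely monotonic if $-(\log f)'$ is completely monotonic. The left-hand side of the equivalence is the conjunction of the two assertions (about $\widehat V_1$ and about $(\log\widehat W_1)'$). *)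

theory Defs
  imports "HOL-Analysis.Analysis"
begin

text \<open>
  Functions on $(0,\infty)$ are total functions on the reals of which only the values at positive
  arguments matter: since $(0,\infty)$ is open, the iterated derivatives at \<open>x > 0\<close> depend only on
  the values of the function near \<open>x\<close>.
\<close>

text \<open>
  \<^const>\<open>deriv\<close> is unspecified where the derivative does not exist, so the existence of all iterated
  derivatives is required explicitly.
\<close>

definition smooth_pos :: "(real \<Rightarrow> real) \<Rightarrow> bool" where
  "smooth_pos f \<longleftrightarrow> (\<forall>n. \<forall>x>0. (deriv ^^ n) f field_differentiable at x)"

definition completely_monotonic :: "(real \<Rightarrow> real) \<Rightarrow> bool" where
  "completely_monotonic f \<longleftrightarrow>
     smooth_pos f \<and> (\<forall>x>0. f x \<ge> 0) \<and> (\<forall>n\<ge>1. \<forall>x>0. (-1) ^ n * (deriv ^^ n) f x \<ge> 0)"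

definition bernstein_function :: "(real \<Rightarrow> real) \<Rightarrow> bool" where
  "bernstein_function g \<longleftrightarrow>
     smooth_pos g \<and> (\<forall>x>0. g x \<ge> 0) \<and> completely_monotonic (deriv g)"

definition log_completely_monotonic :: "(real \<Rightarrow> real) \<Rightarrow> bool" where
  "log_completely_monotonic f \<longleftrightarrow>
     (\<forall>x>0. f x > 0) \<and> (\<forall>x>0. (\<lambda>t. ln (f t)) field_differentiable at x) \<and>
     completely_monotonic (\<lambda>x. - deriv (\<lambda>t. ln (f t)) x)"

definition V1_hat :: "real \<Rightarrow> real \<Rightarrow> real \<Rightarrow> real \<Rightarrow> real" where
  "V1_hat \<alpha> \<beta> a x =
     (Gamma (x / \<alpha> + a) powr \<alpha> * \<alpha> powr x) / (Gamma (x / \<beta> + a) powr \<beta> * \<beta> powr x)"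

definition W1_hat :: "real \<Rightarrow> real \<Rightarrow> real \<Rightarrow> real \<Rightarrow> real" where
  "W1_hat \<alpha> \<beta> a x = Gamma (x / \<alpha> + a) powr \<alpha> / Gamma (x / \<beta> + a) powr \<beta>"

text \<open>
  The library introduces \<^const>\<open>Polygamma\<close> by a series; on the positive half-line \<open>Digamma\<close>
  is the logarithmic derivative of \<^const>\<open>Gamma\<close>.
\<close>

lemma Digamma_eq_deriv_Gamma_div_Gamma:
  fixes x :: real
  assumes "x > 0"
  shows "Digamma x = deriv Gamma x / Gamma x"
proof -
  have nonpos: "x \<notin> \<int>\<^sub>\<le>\<^sub>0"
    using assms by (auto elim!: nonpos_Ints_cases)
  have "(Gamma has_field_derivative Gamma x * Digamma x) (at x)"
    using nonpos by (rule has_field_derivative_Gamma)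
  then have "deriv Gamma x = Gamma x * Digamma x"
    by (rule DERIV_imp_deriv)
  moreover have "Gamma x \<noteq> 0"
    using Gamma_real_pos[OF assms] by simp
  ultimately show ?thesis
    by simp
qed

end

theory Submission
  imports Defs
begin

text \<open>
  Put \<open>\<phi>\<^sub>0 = -\<psi>\<close> and \<open>\<phi>\<^sub>n = (-1)^(n+1) \<psi>^(n)\<close>, so that \<open>\<phi>\<^sub>n' = -\<phi>\<^sub>n\<^sub>+\<^sub>1\<close> and, for \<open>n \<ge> 1\<close>,
  \<open>\<phi>\<^sub>n(x) = n! \<Sum>k. 1/(x+k)^(n+1)\<close>. The function
  \<open>h(x) = -(log V)'(x) = \<psi>(x/\<beta>+a) - ln (x/\<beta>) - (\<psi>(x/\<alpha>+a) - ln (x/\<alpha>))\<close> compares the values of one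
  function at \<open>x/\<beta>\<close> and \<open>x/\<alpha>\<close>, and the same is true of its derivatives: for \<open>n \<ge> 1\<close>,
  \<open>x^n (-1)^n h^(n)(x) = P(x/\<alpha>) - P(x/\<beta>)\<close> with \<open>P(z) = z^n \<phi>\<^sub>n(z+a)\<close>. Complete monotonicity of
  \<open>h\<close> thus becomes the monotonicity of \<open>\<psi>(z+a) - ln z\<close> and of \<open>z^n \<phi>\<^sub>n(z+a)\<close> in \<open>z\<close>.

  If \<open>a \<ge> 1/2\<close>, the first function decreases and the second increases. Differentiating, this amounts
  to \<open>\<phi>\<^sub>1(w) \<le> 1/(w - 1/2)\<close> and \<open>(w - 1/2) \<phi>\<^sub>n\<^sub>+\<^sub>1(w) \<le> n \<phi>\<^sub>n(w)\<close> for \<open>w = z + a\<close>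
  (\<open>abs_polygamma_1_le\<close>, \<open>abs_polygamma_Suc_le\<close>). The first is a telescoping estimate. The second
  follows by summation by parts from the trapezoid rule, which overestimates the integral of the convex
  function \<open>t \<mapsto> (n+1)/t^(n+2)\<close> over an interval of length one.
  Since \<open>(log W)'\<close> differs from \<open>-h\<close> by a constant, the derivatives of \<open>h\<close> also
  show that \<open>(log W)''\<close> is completely monotonic; and \<open>(log W)' \<ge> 0\<close> for \<open>\<alpha> \<le> \<beta>\<close> because \<open>\<psi>\<close>
  increases.

  Conversely, \<open>(log W)' \<ge> 0\<close> at a single point already gives \<open>\<alpha> \<le> \<beta>\<close>. If \<open>a < 1/2\<close>, the trapezoid
  bound \<open>\<phi>\<^sub>1(w) \<ge> 1/w + 1/(2 w^2)\<close> makes \<open>\<psi>(z+a) - ln z\<close> strictly increasing for large \<open>z\<close>, so that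
  \<open>h(x) < 0\<close> for large \<open>x\<close> when \<open>\<alpha> < \<beta>\<close>.
\<close>

section \<open>Inequalities between consecutive polygamma functions\<close>

text \<open>
  For \<open>n \<ge> 1\<close> and \<open>x > 0\<close> this is the absolute value of the \<open>n\<close>-th derivative of the digamma function.
  At \<open>n = 0\<close> it is the negative of the digamma function, whatever its sign, so that the rule
  \<open>\<phi>\<^sub>n' = -\<phi>\<^sub>n\<^sub>+\<^sub>1\<close> holds for all \<open>n\<close>.
\<close>

definition abs_polygamma :: "nat \<Rightarrow> real \<Rightarrow> real" where
  "abs_polygamma n x = (-1) ^ Suc n * Polygamma n x"

lemma abs_polygamma_0: "abs_polygamma 0 x = - Digamma x"
  by (simp add: abs_polygamma_def)

lemma not_nonpos_Int_real_of_pos: "(x::real) > 0 \<Longrightarrow> x \<notin> \<int>\<^sub>\<le>\<^sub>0"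
  by (auto elim!: nonpos_Ints_cases)

lemma has_real_derivative_abs_polygamma:
  assumes "x > 0"
  shows "(abs_polygamma n has_real_derivative - abs_polygamma (Suc n) x) (at x)"
proof -
  have "(Polygamma n has_real_derivative Polygamma (Suc n) x) (at x)"
    by (rule has_field_derivative_Polygamma) (rule not_nonpos_Int_real_of_pos[OF assms])
  from DERIV_cmult[OF this, of "(-1) ^ Suc n"] show ?thesis
    by (simp add: abs_polygamma_def[abs_def])
qed

lemmas has_real_derivative_abs_polygamma_chain [derivative_intros] =
  DERIV_chain2[OF has_real_derivative_abs_polygamma]

lemma abs_polygamma_sums:
  assumes "x > 0" and "n \<ge> 1"
  shows "(\<lambda>k. 1 / (x + real k) ^ Suc n) sums (abs_polygamma n x / fact n)"
  using Polygamma_LIMSEQ[of x n] assms by (simp add: abs_polygamma_def inverse_eq_divide)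

text \<open>
  The left-hand side is the integral of the convex function \<open>p/t^(p+1)\<close> over \<open>[u, u+1]\<close>, the
  right-hand side its trapezoid approximation. The proof is algebraic: with \<open>A = 1/u\<close> and
  \<open>B = 1/(u+1)\<close> one has \<open>A - B = A * B\<close>, so \<open>A^p - B^p\<close> is the sum of the \<open>p\<close> monomials
  \<open>A^(i+1) B^(p-i)\<close>, and two such monomials with exchanged exponents are together at most
  \<open>A^(p+1) + B^(p+1)\<close>.
\<close>

lemma trapezoid_inverse_power:
  fixes u :: real
  assumes "u > 0"
  shows "1 / u ^ p - 1 / (u + 1) ^ p \<le> (real p / u ^ Suc p + real p / (u + 1) ^ Suc p) / 2"
proof -
  define A where "A = 1 / u"
  define B where "B = 1 / (u + 1)"
  have pos: "A > 0" "B > 0"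
    using assms by (auto simp: A_def B_def)
  have AB: "A - B = A * B"
    using assms by (simp add: A_def B_def field_simps)
  have pair: "A ^ Suc i * B ^ (p - i) + A ^ (p - i) * B ^ Suc i \<le> A ^ Suc p + B ^ Suc p"
    if "i < p" for i
  proof -
    \<comment> \<open>The rearrangement inequality: both factors have the sign of \<open>A - B\<close>.\<close>
    have "(A ^ Suc i - B ^ Suc i) * (A ^ (p - i) - B ^ (p - i)) \<ge> 0"
    proof (cases "A \<ge> B")
      case True
      then show ?thesis
        using pos by (intro mult_nonneg_nonneg) (auto intro!: power_mono simp del: power_Suc)
    next
      case False
      then show ?thesis
        using pos by (intro mult_nonpos_nonpos) (auto intro!: power_mono simp del: power_Suc)
    qed
    moreover have "A ^ Suc i * A ^ (p - i) = A ^ Suc p" "B ^ Suc i * B ^ (p - i) = B ^ Suc p"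
      using that by (simp_all only: power_add[symmetric]) auto
    ultimately show ?thesis
      by (simp add: algebra_simps del: power_Suc)
  qed
  have "A ^ p - B ^ p = (A - B) * (\<Sum>i<p. A ^ i * B ^ (p - Suc i))"
    by (simp add: power_diff_sumr2 mult.commute)
  also have "\<dots> = (\<Sum>i<p. A ^ Suc i * B ^ (p - i))"
    unfolding AB sum_distrib_left
  proof (rule sum.cong)
    fix i assume "i \<in> {..<p}"
    then have "p - i = Suc (p - Suc i)" by auto
    then show "A * B * (A ^ i * B ^ (p - Suc i)) = A ^ Suc i * B ^ (p - i)" by simp
  qed simp
  finally have 1: "A ^ p - B ^ p = (\<Sum>i<p. A ^ Suc i * B ^ (p - i))" .
  also have "\<dots> = (\<Sum>i<p. A ^ (p - i) * B ^ Suc i)"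
    by (rule sum.reindex_bij_witness[of _ "\<lambda>i. p - Suc i" "\<lambda>i. p - Suc i"])
       (auto simp: Suc_diff_Suc simp del: power_Suc)
  finally have "2 * (A ^ p - B ^ p) = (\<Sum>i<p. A ^ Suc i * B ^ (p - i) + A ^ (p - i) * B ^ Suc i)"
    using 1 by (simp add: sum.distrib)
  also have "\<dots> \<le> (\<Sum>i<p. A ^ Suc p + B ^ Suc p)"
    using pair by (intro sum_mono) auto
  finally show ?thesis
    by (simp add: A_def B_def power_divide field_simps)
qed

text \<open>
  Summation by parts turns the sum of the \<open>g k\<close> into the sum of \<open>(k + 1) * (g k - g (k + 1))\<close> up to a
  boundary term. After inserting the hypothesis, \<open>m k\<close> receives the weight \<open>k/2\<close> from its left
  neighbour and \<open>(k + 1)/2\<close> from its own term, hence \<open>k + 1/2\<close> altogether; this is where the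
  constant \<open>1/2\<close> of the theorem comes from.
\<close>

lemma sum_le_of_trapezoid:
  fixes g m :: "nat \<Rightarrow> real"
  assumes "\<And>k. g k - g (Suc k) \<le> (m k + m (Suc k)) / 2"
  shows "(\<Sum>k<N. g k) \<le> (\<Sum>k<N. (real k + 1 / 2) * m k) + real N * m N / 2 + real N * g N"
proof (induction N)
  case (Suc N)
  have "(real N + 1) * (g N - g (Suc N)) \<le> (real N + 1) * ((m N + m (Suc N)) / 2)"
    using assms[of N] by (intro mult_left_mono) auto
  with Suc.IH show ?case
    by (simp add: field_simps)
qed simp

text \<open>
  With \<open>g k = 1/(x+k)^(n+1)\<close> and \<open>m k = (n+1)/(x+k)^(n+2)\<close>, the weight \<open>k + 1/2\<close> of the preceding
  estimate splits as \<open>(x + k) - (x - 1/2)\<close>, and \<open>(x + k) * m k = (n + 1) * g k\<close>. The claim is the limit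
  of that estimate, whose boundary terms vanish because \<open>n + 1 \<ge> 2\<close>.
\<close>

lemma abs_polygamma_Suc_le:
  assumes x: "x > 0" and n: "n \<ge> 1"
  shows "(x - 1 / 2) * abs_polygamma (Suc n) x \<le> real n * abs_polygamma n x"
proof -
  define g where "g k = 1 / (x + real k) ^ Suc n" for k
  define m where "m k = real (Suc n) / (x + real k) ^ Suc (Suc n)" for k
  have g_sums: "g sums (abs_polygamma n x / fact n)"
    unfolding g_def using abs_polygamma_sums[OF x n] .
  have m_sums: "m sums (abs_polygamma (Suc n) x / fact n)"
  proof -
    have "(\<lambda>k. real (Suc n) * (1 / (x + real k) ^ Suc (Suc n))) sums
            (real (Suc n) * (abs_polygamma (Suc n) x / fact (Suc n)))"
      using abs_polygamma_sums[OF x, of "Suc n"] by (intro sums_mult) auto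
    moreover have "real (Suc n) * (abs_polygamma (Suc n) x / fact (Suc n)) =
        abs_polygamma (Suc n) x / fact n"
      by (simp add: divide_simps del: of_nat_Suc)
    ultimately show ?thesis
      by (simp add: m_def[abs_def])
  qed
  have m_g: "(x + real k) * m k = real (Suc n) * g k" for k
    using x by (simp add: m_def g_def add_pos_nonneg divide_simps)
  have trapezoid: "(\<Sum>k<N. g k) \<le> (\<Sum>k<N. (real k + 1 / 2) * m k) + real N * m N / 2 + real N * g N" for N
  proof (rule sum_le_of_trapezoid)
    fix k
    show "g k - g (Suc k) \<le> (m k + m (Suc k)) / 2"
      using trapezoid_inverse_power[of "x + real k" "Suc n"] x
      by (simp add: g_def m_def add_ac)
  qed
  have weighted: "(\<Sum>k<N. (real k + 1 / 2) * m k) =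
      real (Suc n) * (\<Sum>k<N. g k) - (x - 1 / 2) * (\<Sum>k<N. m k)" for N
    unfolding sum_distrib_left sum_subtractf[symmetric] m_g[symmetric]
    by (intro sum.cong) (auto simp: algebra_simps)
  have partial: "(x - 1 / 2) * (\<Sum>k<N. m k) \<le>
      real n * (\<Sum>k<N. g k) + (real N * m N / 2 + real N * g N)" for N
    using trapezoid[of N] unfolding weighted by (simp add: algebra_simps)
  have Ng: "(\<lambda>N. real N * g N) \<longlonglongrightarrow> 0"
  proof (rule tendsto_sandwich[OF _ _ tendsto_const])
    show "eventually (\<lambda>N. 0 \<le> real N * g N) sequentially"
      using x by (simp add: g_def)
    show "eventually (\<lambda>N. real N * g N \<le> 1 / real N) sequentially"
      using eventually_ge_at_top[of 1]
    proof eventually_elim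
      case (elim N)
      have "real N ^ 2 \<le> real N ^ Suc n"
        using elim n by (intro power_increasing) auto
      also have "\<dots> \<le> (x + real N) ^ Suc n"
        using x by (intro power_mono) auto
      finally have "g N \<le> 1 / real N ^ 2"
        using elim x unfolding g_def
        by (intro divide_left_mono mult_pos_pos zero_less_power add_pos_pos) auto
      then have "real N * g N \<le> real N * (1 / real N ^ 2)"
        by (intro mult_left_mono) auto
      then show ?case
        using elim by (simp add: power2_eq_square)
    qed
    show "(\<lambda>N. 1 / real N) \<longlonglongrightarrow> 0"
      by (rule lim_1_over_n)
  qed
  have Nm: "(\<lambda>N. real N * m N) \<longlonglongrightarrow> 0"
  proof (rule tendsto_sandwich[OF _ _ tendsto_const])
    show "eventually (\<lambda>N. 0 \<le> real N * m N) sequentially"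
      using x by (simp add: m_def)
    show "eventually (\<lambda>N. real N * m N \<le> real (Suc n) * g N) sequentially"
    proof (rule always_eventually, rule allI)
      fix N
      have "real N * m N \<le> (x + real N) * m N"
        using x by (intro mult_right_mono) (auto simp: m_def)
      then show "real N * m N \<le> real (Suc n) * g N"
        using m_g[of N] by simp
    qed
    show "(\<lambda>N. real (Suc n) * g N) \<longlonglongrightarrow> 0"
      using tendsto_mult_right_zero[OF summable_LIMSEQ_zero[OF sums_summable[OF g_sums]]] .
  qed
  have "(x - 1 / 2) * (abs_polygamma (Suc n) x / fact n) \<le>
      real n * (abs_polygamma n x / fact n) + (0 / 2 + 0)"
  proof (rule LIMSEQ_le)
    show "(\<lambda>N. (x - 1 / 2) * (\<Sum>k<N. m k)) \<longlonglongrightarrow> (x - 1 / 2) * (abs_polygamma (Suc n) x / fact n)"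
      using m_sums unfolding sums_def by (intro tendsto_intros)
    show "(\<lambda>N. real n * (\<Sum>k<N. g k) + (real N * m N / 2 + real N * g N)) \<longlonglongrightarrow>
        real n * (abs_polygamma n x / fact n) + (0 / 2 + 0)"
      using g_sums unfolding sums_def by (intro tendsto_intros Nm Ng) auto
  qed (use partial in auto)
  then have "((x - 1 / 2) * abs_polygamma (Suc n) x) / fact n \<le> (real n * abs_polygamma n x) / fact n"
    by simp
  then show ?thesis
    by (simp only: divide_le_cancel) simp
qed

lemma reciprocal_difference_sums:
  fixes x :: real
  shows "(\<lambda>k. 1 / (x + real k) - 1 / (x + real (Suc k))) sums (1 / x)"
proof -
  have "filterlim (\<lambda>k. x + real k) at_infinity sequentially"
    by (intro filterlim_at_top_imp_at_infinity filterlim_tendsto_add_at_top[OF tendsto_const]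
        filterlim_real_sequentially)
  then have "(\<lambda>k. 1 / (x + real k)) \<longlonglongrightarrow> 0"
    by (intro tendsto_divide_0[OF tendsto_const])
  from telescope_sums'[OF this] show ?thesis by simp
qed

text \<open>
  Termwise, \<open>1/u^2 \<le> 1/(u^2 - 1/4) = 1/(u - 1/2) - 1/(u + 1/2)\<close>, and the right-hand sides telescope.
\<close>

lemma abs_polygamma_1_le:
  assumes "x > 1 / 2"
  shows "abs_polygamma 1 x \<le> 1 / (x - 1 / 2)"
proof -
  have s1: "(\<lambda>k. 1 / (x + real k) ^ 2) sums abs_polygamma 1 x"
    using abs_polygamma_sums[of x 1] assms by (simp add: numeral_2_eq_2)
  show ?thesis
  proof (rule sums_le[OF _ s1 reciprocal_difference_sums[of "x - 1 / 2"]])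
    fix k :: nat
    define u where "u = x + real k"
    have u: "u > 1 / 2" using assms by (simp add: u_def)
    have "u ^ 2 \<noteq> 0" "u ^ 2 - 1 / 4 > 0"
      using u power_strict_mono[of "1/2" u 2] by (auto simp: power2_eq_square)
    then have "1 / u ^ 2 \<le> 1 / (u ^ 2 - 1 / 4)"
      by (intro divide_left_mono) (auto simp: zero_less_mult_iff)
    also have "u ^ 2 - 1 / 4 = (u - 1 / 2) * (u + 1 / 2)"
      by (simp add: algebra_simps power2_eq_square)
    also have "1 / \<dots> = 1 / (u - 1 / 2) - 1 / (u + 1 / 2)"
      using u by (simp add: divide_simps)
    finally show "1 / (x + real k) ^ 2 \<le>
        1 / (x - 1 / 2 + real k) - 1 / (x - 1 / 2 + real (Suc k))"
      by (simp add: u_def algebra_simps)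
  qed
qed

text \<open>
  Summing the trapezoid inequality counts every term of the series once, except that the first one,
  \<open>1/x^2\<close>, is counted with weight \<open>1/2\<close>; this produces the correction \<open>1/(2 x^2)\<close>.
\<close>

lemma abs_polygamma_1_ge:
  assumes x: "x > 0"
  shows "abs_polygamma 1 x \<ge> 1 / x + 1 / (2 * x ^ 2)"
proof -
  define m where "m k = 1 / (x + real k) ^ 2" for k
  have m: "m sums abs_polygamma 1 x"
    using abs_polygamma_sums[OF x, of 1] by (simp add: m_def[abs_def] numeral_2_eq_2)
  then have m': "(\<lambda>k. m (Suc k)) sums (abs_polygamma 1 x - m 0)"
    by (subst sums_Suc_iff) simp
  have "1 / x \<le> (abs_polygamma 1 x + (abs_polygamma 1 x - m 0)) / 2"
  proof (rule sums_le[OF _ reciprocal_difference_sums sums_divide[OF sums_add[OF m m']]])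
    fix k
    show "1 / (x + real k) - 1 / (x + real (Suc k)) \<le> (m k + m (Suc k)) / 2"
      using trapezoid_inverse_power[of "x + real k" 1] x
      by (simp add: m_def power2_eq_square add_ac)
  qed
  then show ?thesis
    by (simp add: m_def)
qed

section \<open>Shifted polygamma functions compared with powers and logarithm\<close>

lemma abs_polygamma_nonneg:
  assumes "x > 0" and "n \<ge> 1"
  shows "abs_polygamma n x \<ge> 0"
proof -
  have "abs_polygamma n x / fact n \<ge> 0"
    by (rule sums_le[OF _ sums_zero abs_polygamma_sums[OF assms]]) (use assms in auto)
  from mult_nonneg_nonneg[OF fact_ge_zero[of n] this] show ?thesis
    by simp
qed

text \<open>
  The sign of the derivative is that of \<open>n \<phi>\<^sub>n(z+a) - z \<phi>\<^sub>n\<^sub>+\<^sub>1(z+a)\<close>, and \<open>z \<le> (z + a) - 1/2\<close>.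
\<close>

lemma power_mult_abs_polygamma_mono:
  fixes z z' a :: real
  assumes n: "n \<ge> 1" and a: "a \<ge> 1 / 2" and z: "0 < z" "z \<le> z'"
  shows "z ^ n * abs_polygamma n (z + a) \<le> z' ^ n * abs_polygamma n (z' + a)"
proof (rule DERIV_nonneg_imp_nondecreasing[where f = "\<lambda>z. z ^ n * abs_polygamma n (z + a)", OF z(2)])
  fix t assume "z \<le> t" "t \<le> z'"
  with z a have t: "t > 0" "t + a > 0" by auto
  let ?D = "real n * t ^ (n - 1) * abs_polygamma n (t + a) - t ^ n * abs_polygamma (Suc n) (t + a)"
  have "((\<lambda>z. z ^ n * abs_polygamma n (z + a)) has_real_derivative ?D) (at t)"
    using t by (auto intro!: derivative_eq_intros)
  moreover have "?D \<ge> 0"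
  proof -
    have "abs_polygamma (Suc n) (t + a) \<ge> 0"
      using t by (intro abs_polygamma_nonneg) auto
    then have "t * abs_polygamma (Suc n) (t + a) \<le> (t + a - 1 / 2) * abs_polygamma (Suc n) (t + a)"
      using a by (intro mult_right_mono) auto
    also have "\<dots> \<le> real n * abs_polygamma n (t + a)"
      by (rule abs_polygamma_Suc_le[OF t(2) n])
    finally have "t ^ (n - 1) * (t * abs_polygamma (Suc n) (t + a)) \<le>
        t ^ (n - 1) * (real n * abs_polygamma n (t + a))"
      using t by (intro mult_left_mono) auto
    moreover have "t ^ n = t ^ (n - 1) * t"
      using n by (cases n) auto
    ultimately show ?thesis
      by (simp add: algebra_simps)
  qed
  ultimately show "\<exists>y. ((\<lambda>z. z ^ n * abs_polygamma n (z + a)) has_real_derivative y) (at t) \<and> 0 \<le> y"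
    by blast
qed

lemma Digamma_minus_ln_antimono:
  fixes z z' a :: real
  assumes a: "a \<ge> 1 / 2" and z: "0 < z" "z \<le> z'"
  shows "Digamma (z' + a) - ln z' \<le> Digamma (z + a) - ln z"
proof -
  have "abs_polygamma 0 (z + a) + ln z \<le> abs_polygamma 0 (z' + a) + ln z'"
  proof (rule DERIV_nonneg_imp_nondecreasing[where f = "\<lambda>z. abs_polygamma 0 (z + a) + ln z", OF z(2)])
    fix t assume "z \<le> t" "t \<le> z'"
    with z a have t: "t > 0" "t + a > 0" by auto
    have "((\<lambda>z. abs_polygamma 0 (z + a) + ln z) has_real_derivative
        (1 / t - abs_polygamma 1 (t + a))) (at t)"
      using t by (auto intro!: derivative_eq_intros)
    moreover have "abs_polygamma 1 (t + a) \<le> 1 / (t + a - 1 / 2)"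
      using t a by (intro abs_polygamma_1_le) auto
    moreover have "1 / (t + a - 1 / 2) \<le> 1 / t"
      using t a by (intro divide_left_mono) auto
    ultimately show "\<exists>y. ((\<lambda>z. abs_polygamma 0 (z + a) + ln z) has_real_derivative y) (at t) \<and> 0 \<le> y"
      by (intro exI conjI) auto
  qed
  then show ?thesis
    by (simp add: abs_polygamma_0)
qed

text \<open>
  The derivative is \<open>\<phi>\<^sub>1(t+a) - 1/t\<close>, and \<open>1/(t+a) + 1/(2 (t+a)^2) > 1/t\<close> is equivalent to
  \<open>2 a (t + a) < t\<close>, that is to \<open>2 a^2 < (1 - 2 a) t\<close>. As \<open>2 a^2 \<le> a\<close>, it is enough that
  \<open>t > a/(1 - 2 a)\<close>.
\<close>

lemma Digamma_minus_ln_strict_mono: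
  fixes z z' a :: real
  assumes a: "0 \<le> a" "a < 1 / 2" and z: "a / (1 - 2 * a) < z" "z < z'"
  shows "Digamma (z + a) - ln z < Digamma (z' + a) - ln z'"
proof -
  have "- abs_polygamma 0 (z + a) - ln z < - abs_polygamma 0 (z' + a) - ln z'"
  proof (rule DERIV_pos_imp_increasing[where f = "\<lambda>z. - abs_polygamma 0 (z + a) - ln z", OF z(2)])
    fix t assume "z \<le> t" "t \<le> z'"
    with z have big: "a / (1 - 2 * a) < t" by auto
    then have t: "t > 0"
      using divide_nonneg_pos[of a "1 - 2 * a"] a by linarith
    have "a < (1 - 2 * a) * t"
      using big a by (simp only: pos_divide_less_eq mult.commute diff_gt_0_iff_gt)
    moreover have "2 * a * a \<le> a"
      using a mult_left_mono[of "2 * a" 1 a] by (simp add: algebra_simps)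
    ultimately have "2 * a * (t + a) < t"
      by (simp add: algebra_simps)
    then have "2 * a * (t + a) / (2 * t * (t + a) ^ 2) < t / (2 * t * (t + a) ^ 2)"
      using t a by (intro divide_strict_right_mono) auto
    moreover have "2 * a * (t + a) / (2 * t * (t + a) ^ 2) = 1 / t - 1 / (t + a)"
    proof -
      have "2 * a * (t + a) / (2 * t * (t + a) ^ 2) = a / (t * (t + a))"
        using t a by (simp add: power2_eq_square)
      also have "\<dots> = 1 / t - 1 / (t + a)"
        using t a by (simp add: diff_frac_eq)
      finally show ?thesis .
    qed
    moreover have "t / (2 * t * (t + a) ^ 2) = 1 / (2 * (t + a) ^ 2)"
      using t by simp
    ultimately have "1 / t < 1 / (t + a) + 1 / (2 * (t + a) ^ 2)"
      by simp
    also have "\<dots> \<le> abs_polygamma 1 (t + a)"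
      using t a by (intro abs_polygamma_1_ge) auto
    finally have "abs_polygamma 1 (t + a) - 1 / t > 0"
      by simp
    moreover have "((\<lambda>z. - abs_polygamma 0 (z + a) - ln z) has_real_derivative
        (abs_polygamma 1 (t + a) - 1 / t)) (at t)"
      using t a by (auto intro!: derivative_eq_intros)
    ultimately show "\<exists>y. ((\<lambda>z. - abs_polygamma 0 (z + a) - ln z) has_real_derivative y) (at t) \<and> 0 < y"
      by blast
  qed
  then show ?thesis
    by (simp add: abs_polygamma_0)
qed

section \<open>Complete monotonicity from a sequence of derivatives\<close>

text \<open>
  The equation between \<open>f\<close> and \<open>D 0\<close> is required only on the open half-line, since functions such as
  \<^term>\<open>deriv (\<lambda>t. ln (W1_hat \<alpha> \<beta> a t))\<close> are given by a formula only there. Openness suffices to transport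
  all derivatives.
\<close>

lemma higher_deriv_eq_on_pos:
  fixes f :: "real \<Rightarrow> real"
  assumes "\<And>x. x > 0 \<Longrightarrow> f x = D 0 x"
    and "\<And>n x. x > 0 \<Longrightarrow> (D n has_real_derivative D (Suc n) x) (at x)"
  shows "x > 0 \<Longrightarrow> (deriv ^^ n) f x = D n x"
    and "x > 0 \<Longrightarrow> ((deriv ^^ n) f has_real_derivative D (Suc n) x) (at x)"
proof -
  have "\<forall>x>0. (deriv ^^ n) f x = D n x \<and> ((deriv ^^ n) f has_real_derivative D (Suc n) x) (at x)"
    (is "\<forall>x>0. ?P n x")
  proof (induction n)
    case 0
    show ?case
      using assms by (auto intro!: has_field_derivative_transform_within_open[OF assms(2), of _ "{0<..}"])
  next
    case (Suc n)
    then have *: "(deriv ^^ Suc n) f x = D (Suc n) x" if "x > 0" for x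
      using that by (auto intro: DERIV_imp_deriv)
    moreover have "((deriv ^^ Suc n) f has_real_derivative D (Suc (Suc n)) x) (at x)" if "x > 0" for x
      using * that
      by (intro has_field_derivative_transform_within_open[OF assms(2), of x "{0<..}"]) auto
    ultimately show ?case by blast
  qed
  then show "x > 0 \<Longrightarrow> (deriv ^^ n) f x = D n x"
    and "x > 0 \<Longrightarrow> ((deriv ^^ n) f has_real_derivative D (Suc n) x) (at x)"
    by auto
qed

lemma completely_monotonicI:
  assumes "\<And>x. x > 0 \<Longrightarrow> f x = D 0 x"
    and "\<And>n x. x > 0 \<Longrightarrow> (D n has_real_derivative D (Suc n) x) (at x)"
    and "\<And>n x. x > 0 \<Longrightarrow> (-1) ^ n * D n x \<ge> 0"
  shows "completely_monotonic f"
proof -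
  note D = higher_deriv_eq_on_pos[of f D, OF assms(1,2)]
  have "smooth_pos f"
    unfolding smooth_pos_def field_differentiable_def using D(2) by blast
  then show ?thesis
    using D(1) assms(1) assms(3)[of _ 0] assms(3) by (auto simp: completely_monotonic_def)
qed

lemma bernstein_functionI:
  assumes "\<And>x. x > 0 \<Longrightarrow> g x = D 0 x"
    and "\<And>n x. x > 0 \<Longrightarrow> (D n has_real_derivative D (Suc n) x) (at x)"
    and "\<And>x. x > 0 \<Longrightarrow> D 0 x \<ge> 0"
    and "\<And>n x. x > 0 \<Longrightarrow> (-1) ^ n * D (Suc n) x \<ge> 0"
  shows "bernstein_function g"
proof -
  note D = higher_deriv_eq_on_pos[of g D, OF assms(1,2)]
  have "completely_monotonic (deriv g)"
    using D(1)[of _ 1] assms(2,4) by (intro completely_monotonicI[of _ "\<lambda>n. D (Suc n)"]) auto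
  moreover have "smooth_pos g"
    unfolding smooth_pos_def field_differentiable_def using D(2) by blast
  ultimately show ?thesis
    using assms(1,3) by (auto simp: bernstein_function_def)
qed

section \<open>The gamma quotients\<close>

lemma has_real_derivative_ln_Gamma_powr:
  assumes "c > 0" "a \<ge> 0" "x > 0"
  shows "((\<lambda>t. ln (Gamma (t / c + a) powr c)) has_real_derivative Digamma (x / c + a)) (at x)"
proof -
  have "((\<lambda>t. c * ln_Gamma (t / c + a)) has_real_derivative Digamma (x / c + a)) (at x)"
    using assms by (auto intro!: derivative_eq_intros DERIV_chain2[OF has_field_derivative_ln_Gamma_real]
        simp: add_pos_nonneg)
  then show ?thesis
  proof (rule has_field_derivative_transform_within_open[of _ _ _ "{0<..}"])
    fix t :: real assume "t \<in> {0<..}"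
    then have "t / c + a > 0" using assms by (simp add: add_pos_nonneg)
    then show "c * ln_Gamma (t / c + a) = ln (Gamma (t / c + a) powr c)"
      using Gamma_real_pos[of "t / c + a"] by (simp add: ln_powr ln_Gamma_real_pos)
  qed (use assms in auto)
qed

lemma has_real_derivative_ln_W1_hat:
  assumes "\<alpha> > 0" "\<beta> > 0" "a \<ge> 0" "x > 0"
  shows "((\<lambda>t. ln (W1_hat \<alpha> \<beta> a t)) has_real_derivative
           Digamma (x / \<alpha> + a) - Digamma (x / \<beta> + a)) (at x)"
proof (rule has_field_derivative_transform_within_open[of _ _ _ "{0<..}"])
  show "((\<lambda>t. ln (Gamma (t / \<alpha> + a) powr \<alpha>) - ln (Gamma (t / \<beta> + a) powr \<beta>))
      has_real_derivative Digamma (x / \<alpha> + a) - Digamma (x / \<beta> + a)) (at x)"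
    using assms by (intro DERIV_diff has_real_derivative_ln_Gamma_powr)
  fix t :: real assume "t \<in> {0<..}"
  then have "t / \<alpha> + a > 0" "t / \<beta> + a > 0" using assms by (auto simp: add_pos_nonneg)
  from this[THEN Gamma_real_pos]
  show "ln (Gamma (t / \<alpha> + a) powr \<alpha>) - ln (Gamma (t / \<beta> + a) powr \<beta>) = ln (W1_hat \<alpha> \<beta> a t)"
    by (simp add: W1_hat_def ln_div)
qed (use assms in auto)

lemma V1_hat_pos:
  assumes "\<alpha> > 0" "\<beta> > 0" "a \<ge> 0" "x > 0"
  shows "V1_hat \<alpha> \<beta> a x > 0"
proof -
  have "x / \<alpha> + a > 0" "x / \<beta> + a > 0" using assms by (auto simp: add_pos_nonneg)
  from this[THEN Gamma_real_pos] show ?thesis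
    using assms by (simp add: V1_hat_def)
qed

lemma has_real_derivative_ln_V1_hat:
  assumes "\<alpha> > 0" "\<beta> > 0" "a \<ge> 0" "x > 0"
  shows "((\<lambda>t. ln (V1_hat \<alpha> \<beta> a t)) has_real_derivative
           Digamma (x / \<alpha> + a) + ln \<alpha> - (Digamma (x / \<beta> + a) + ln \<beta>)) (at x)"
proof (rule has_field_derivative_transform_within_open[of _ _ _ "{0<..}"])
  show "((\<lambda>t. (ln (Gamma (t / \<alpha> + a) powr \<alpha>) + t * ln \<alpha>) -
        (ln (Gamma (t / \<beta> + a) powr \<beta>) + t * ln \<beta>))
      has_real_derivative Digamma (x / \<alpha> + a) + ln \<alpha> - (Digamma (x / \<beta> + a) + ln \<beta>)) (at x)"
    using assms
    by (intro DERIV_diff DERIV_add has_real_derivative_ln_Gamma_powr)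
       (auto intro!: derivative_eq_intros)
  fix t :: real assume "t \<in> {0<..}"
  then have "t / \<alpha> + a > 0" "t / \<beta> + a > 0" using assms by (auto simp: add_pos_nonneg)
  from this[THEN Gamma_real_pos]
  show "(ln (Gamma (t / \<alpha> + a) powr \<alpha>) + t * ln \<alpha>) -
      (ln (Gamma (t / \<beta> + a) powr \<beta>) + t * ln \<beta>) = ln (V1_hat \<alpha> \<beta> a t)"
    using assms by (simp add: V1_hat_def ln_div ln_mult ln_powr)
qed (use assms in auto)

text \<open>
  The \<open>n\<close>-th derivative of \<open>-(log W)'\<close>, written out so that the factor \<open>(-1)^n\<close> of complete
  monotonicity is visible. For \<open>n \<ge> 1\<close> it is also the \<open>n\<close>-th derivative of \<open>-(log V)'\<close>.
\<close>

definition neg_ln_W1_deriv :: "real \<Rightarrow> real \<Rightarrow> real \<Rightarrow> nat \<Rightarrow> real \<Rightarrow> real" where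
  "neg_ln_W1_deriv \<alpha> \<beta> a n x =
     (-1) ^ n * (abs_polygamma n (x / \<alpha> + a) / \<alpha> ^ n - abs_polygamma n (x / \<beta> + a) / \<beta> ^ n)"

lemma neg_ln_W1_deriv_0:
  "neg_ln_W1_deriv \<alpha> \<beta> a 0 x = Digamma (x / \<beta> + a) - Digamma (x / \<alpha> + a)"
  by (simp add: neg_ln_W1_deriv_def abs_polygamma_0)

lemma has_real_derivative_neg_ln_W1_deriv:
  assumes "\<alpha> > 0" "\<beta> > 0" "a \<ge> 0" "x > 0"
  shows "(neg_ln_W1_deriv \<alpha> \<beta> a n has_real_derivative neg_ln_W1_deriv \<alpha> \<beta> a (Suc n) x) (at x)"
  unfolding neg_ln_W1_deriv_def[abs_def] using assms
  by (auto intro!: derivative_eq_intros simp: add_pos_nonneg field_simps)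

text \<open>
  Multiplication by \<open>x^n\<close> turns the two terms of the definition into the values of
  \<open>z^n \<phi>\<^sub>n(z+a)\<close> at \<open>x/\<alpha>\<close> and \<open>x/\<beta>\<close>.
\<close>

lemma neg_ln_W1_deriv_sign:
  assumes pos: "\<alpha> > 0" "\<beta> > 0" and le: "\<alpha> \<le> \<beta>" and a: "\<alpha> \<noteq> \<beta> \<Longrightarrow> a \<ge> 1 / 2"
    and x: "x > 0" and n: "n \<ge> 1"
  shows "(-1) ^ n * neg_ln_W1_deriv \<alpha> \<beta> a n x \<ge> 0"
proof (cases "\<alpha> = \<beta>")
  case True
  then show ?thesis by (simp add: neg_ln_W1_deriv_def)
next
  case False
  have "(x / \<beta>) ^ n * abs_polygamma n (x / \<beta> + a) \<le> (x / \<alpha>) ^ n * abs_polygamma n (x / \<alpha> + a)"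
    using pos x le
    by (intro power_mult_abs_polygamma_mono n a False) (auto intro!: divide_left_mono)
  then have "x ^ n * (abs_polygamma n (x / \<beta> + a) / \<beta> ^ n) \<le>
      x ^ n * (abs_polygamma n (x / \<alpha> + a) / \<alpha> ^ n)"
    by (simp add: power_divide)
  then have "abs_polygamma n (x / \<beta> + a) / \<beta> ^ n \<le> abs_polygamma n (x / \<alpha> + a) / \<alpha> ^ n"
    using x by (subst (asm) mult_le_cancel_left_pos) auto
  moreover have "(-1) ^ n * ((-1) ^ n * y) = (y::real)" for y
    by (simp add: mult.assoc[symmetric] power_mult_distrib[symmetric])
  ultimately show ?thesis
    by (simp add: neg_ln_W1_deriv_def)
qed

theorem theorem3p13:
  fixes \<alpha> \<beta> a :: real
  assumes "\<alpha> > 0" and "\<beta> > 0" and "a \<ge> 0"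
  shows "(\<forall>x>0. ((\<lambda>t. ln (W1_hat \<alpha> \<beta> a t)) has_real_derivative
                  Digamma (x / \<alpha> + a) - Digamma (x / \<beta> + a)) (at x)) \<and>
         ((log_completely_monotonic (V1_hat \<alpha> \<beta> a) \<and>
           bernstein_function (deriv (\<lambda>t. ln (W1_hat \<alpha> \<beta> a t))))
          \<longleftrightarrow> (\<alpha> \<le> \<beta> \<and> (\<alpha> \<noteq> \<beta> \<longrightarrow> a \<ge> 1 / 2)))"
proof (intro conjI iffI allI impI)
  note W' = has_real_derivative_ln_W1_hat[OF assms]
  note V' = has_real_derivative_ln_V1_hat[OF assms]
  show "((\<lambda>t. ln (W1_hat \<alpha> \<beta> a t)) has_real_derivative
      Digamma (x / \<alpha> + a) - Digamma (x / \<beta> + a)) (at x)" if "x > 0" for x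
    using W'[OF that] .
  have W: "deriv (\<lambda>t. ln (W1_hat \<alpha> \<beta> a t)) x = Digamma (x / \<alpha> + a) - Digamma (x / \<beta> + a)"
    if "x > 0" for x
    using W'[OF that] by (rule DERIV_imp_deriv)
  \<comment> \<open>The constant \<open>ln \<beta> - ln \<alpha>\<close> is absorbed into logarithms, so that both summands are values of
    the same function \<open>\<psi>(z+a) - ln z\<close>.\<close>
  have V: "- deriv (\<lambda>t. ln (V1_hat \<alpha> \<beta> a t)) x =
      (Digamma (x / \<beta> + a) - ln (x / \<beta>)) - (Digamma (x / \<alpha> + a) - ln (x / \<alpha>))" if "x > 0" for x
    using DERIV_imp_deriv[OF V'[OF that]] assms that by (simp add: ln_div)
  {
    assume L: "log_completely_monotonic (V1_hat \<alpha> \<beta> a) \<and>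
      bernstein_function (deriv (\<lambda>t. ln (W1_hat \<alpha> \<beta> a t)))"
    show le: "\<alpha> \<le> \<beta>"
    proof (rule ccontr)
      assume "\<not> \<alpha> \<le> \<beta>"
      then have "1 / \<alpha> + a < 1 / \<beta> + a"
        using assms by (simp add: frac_less2)
      then have "Digamma (1 / \<alpha> + a) < Digamma (1 / \<beta> + a)"
        using assms by (intro Digamma_real_strict_mono) (auto simp: add_pos_nonneg)
      moreover have "deriv (\<lambda>t. ln (W1_hat \<alpha> \<beta> a t)) 1 \<ge> 0"
        using L by (simp add: bernstein_function_def)
      ultimately show False
        using W[of 1] by simp
    qed
    show "a \<ge> 1 / 2" if "\<alpha> \<noteq> \<beta>"
    proof (rule ccontr)
      assume "\<not> a \<ge> 1 / 2"
      then have a: "a < 1 / 2" by simp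
      \<comment> \<open>A point for which both \<open>x/\<beta>\<close> and \<open>x/\<alpha>\<close> lie where \<open>\<psi>(z+a) - ln z\<close> strictly increases.\<close>
      define x where "x = \<beta> * (a / (1 - 2 * a) + 1)"
      have "a / (1 - 2 * a) \<ge> 0" using a assms by simp
      then have x: "x > 0" using assms by (simp add: x_def)
      have "a / (1 - 2 * a) < x / \<beta>"
        using assms by (simp add: x_def)
      moreover have "x / \<beta> < x / \<alpha>"
        using le that x assms by (intro divide_strict_left_mono) auto
      ultimately have "Digamma (x / \<beta> + a) - ln (x / \<beta>) < Digamma (x / \<alpha> + a) - ln (x / \<alpha>)"
        by (intro Digamma_minus_ln_strict_mono assms a)
      moreover have "- deriv (\<lambda>t. ln (V1_hat \<alpha> \<beta> a t)) x \<ge> 0"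
        using L x unfolding log_completely_monotonic_def completely_monotonic_def by blast
      ultimately show False
        using V[OF x] by simp
    qed
  }
  {
    assume R: "\<alpha> \<le> \<beta> \<and> (\<alpha> \<noteq> \<beta> \<longrightarrow> a \<ge> 1 / 2)"
    let ?H = "neg_ln_W1_deriv \<alpha> \<beta> a"
    note H' = has_real_derivative_neg_ln_W1_deriv[OF assms]
    have H_sign: "(-1) ^ n * ?H n x \<ge> 0" if "n \<ge> 1" "x > 0" for n x
      using neg_ln_W1_deriv_sign[of \<alpha> \<beta> a x n] assms R that by blast
    show "log_completely_monotonic (V1_hat \<alpha> \<beta> a)"
      unfolding log_completely_monotonic_def
    proof (intro conjI allI impI)
      show "V1_hat \<alpha> \<beta> a x > 0" if "x > 0" for x
        using V1_hat_pos[OF assms that] .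
      show "(\<lambda>t. ln (V1_hat \<alpha> \<beta> a t)) field_differentiable at x" if "x > 0" for x
        using V'[OF that] by (auto simp: field_differentiable_def)
      \<comment> \<open>\<open>-(log V)'\<close> and \<open>-(log W)'\<close> differ by a constant, which only the derivative of order zero sees.\<close>
      let ?D = "\<lambda>n x. ?H n x + (if n = 0 then ln \<beta> - ln \<alpha> else 0)"
      show "completely_monotonic (\<lambda>x. - deriv (\<lambda>t. ln (V1_hat \<alpha> \<beta> a t)) x)"
      proof (rule completely_monotonicI[of _ ?D])
        show V0: "- deriv (\<lambda>t. ln (V1_hat \<alpha> \<beta> a t)) x = ?D 0 x" if "x > 0" for x
          using DERIV_imp_deriv[OF V'[OF that]] by (simp add: neg_ln_W1_deriv_0)
        show "(?D n has_real_derivative ?D (Suc n) x) (at x)" if "x > 0" for n x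
          using H'[OF that, of n] by (auto intro!: derivative_eq_intros)
        show "(-1) ^ n * ?D n x \<ge> 0" if x: "x > 0" for n x
        proof (cases "n = 0")
          case True
          have "Digamma (x / \<alpha> + a) - ln (x / \<alpha>) \<le> Digamma (x / \<beta> + a) - ln (x / \<beta>)"
          proof (cases "\<alpha> = \<beta>")
            case False
            then show ?thesis
              using R assms x by (intro Digamma_minus_ln_antimono) (auto intro!: divide_left_mono)
          qed simp
          then show ?thesis
            using V[OF x] V0[OF x] True by simp
        next
          case False
          then show ?thesis
            using H_sign[of n x] x by simp
        qed
      qed
    qed
    show "bernstein_function (deriv (\<lambda>t. ln (W1_hat \<alpha> \<beta> a t)))"
    proof (rule bernstein_functionI[of _ "\<lambda>n x. - ?H n x"])
      show W0: "deriv (\<lambda>t. ln (W1_hat \<alpha> \<beta> a t)) x = - ?H 0 x" if "x > 0" for x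
        using W[OF that] by (simp add: neg_ln_W1_deriv_0)
      show "((\<lambda>x. - ?H n x) has_real_derivative - ?H (Suc n) x) (at x)" if "x > 0" for n x
        using H'[OF that] by (rule DERIV_minus)
      show "- ?H 0 x \<ge> 0" if "x > 0" for x
      proof -
        have "x / \<beta> + a \<le> x / \<alpha> + a"
          using R assms that by (auto intro!: divide_left_mono)
        then have "Digamma (x / \<beta> + a) \<le> Digamma (x / \<alpha> + a)"
          using assms that by (intro Digamma_real_mono) (auto simp: add_pos_nonneg)
        then show ?thesis by (simp add: neg_ln_W1_deriv_0)
      qed
      show "(-1) ^ n * - ?H (Suc n) x \<ge> 0" if "x > 0" for n x
        using H_sign[of "Suc n" x] that by simp
    qed
  }
qed

end
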